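(* Let $\alpha$ be an ordinal and let $\Gamma$ be a sequent of $\mu\mathsf{MALL}_{\alpha,\alpha}$. If $\Gamma$ is provable in $\mu\mathsf{MALL}_{\alpha,\alpha}$, then $\Gamma$ is provable in $\mu\mathsf{MALL}_{\alpha,\alpha}^{\mathit{cf}}$, the system $\mu\mathsf{MALL}_{\alpha,\alpha}$ without the $\mathsf{cut}$ rule.
   Context: Syntax. Fix disjoint countably infinite sets $\mathsf{Var}$ (variables $x,y,\dots$) and $\mathsf{Prop}$ (propositional symbols $p,q,\dots$) and an ordinal $\alpha$. Formulas of $\mu\mathsf{MALL}_{\alpha,\alpha}$ are generated by $x \mid p \mid p^\perp \mid 1 \mid \bot \mid 0 \mid \top \mid A\otimes B \mid A \wp B \mid A\oplus B \mid A \mathbin{\&} B \mid \mu^\beta x A \mid \nu^\beta x A$ with $\beta\le\alpha$ ($\wp$ denotes multiplicative disjunction, "par"); $\mu^\beta x$, $\nu^\beta x$ bind $x$. Negation $A^\perp$ is defined by $x^\perp=x$, $(p^\perp)^\perp=p$, and the De Morgan dualities $1/\bot$, $0/\top$, $\otimes/\wp$, $\oplus/\&$, $\mu^\beta x/\nu^\beta x$ (e.g. $(\mu^\beta x A)^\perp=\nu^\beta x A^\perp$). A sequent is a finite multiset of formulas; $A(B)$ denotes capture-avoiding substitution of $B$ for $x$ in $A(x)$. System $\mu\mathsf{MALL}_{\alpha,\alpha}$. Rules (premises / conclusion): ($\mathsf{id}$) no premise / $A,A^\perp$; ($\mathsf{cut}$) $\Gamma,A$ and $\Delta,A^\perp$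 / $\Gamma,\Delta$; ($1$) no premise / $1$; ($\bot$) $\Gamma$ / $\Gamma,\bot$; ($\top$) no premise / $\Gamma,\top$; no rule for $0$; ($\otimes$) $\Gamma,A$ and $\Delta,B$ / $\Gamma,\Delta,A\otimes B$; ($\wp$) $\Gamma,A,B$ / $\Gamma,A\wp B$; ($\oplus$) $\Gamma,A_i$ / $\Gamma,A_0\oplus A_1$ ($i\in\{0,1\}$); ($\&$) $\Gamma,A$ and $\Gamma,B$ / $\Gamma,A\mathbin{\&}B$; and for each $\beta\le\alpha$: ($\mu^\beta$) $\Gamma,A(\mu^\gamma x A(x))$ / $\Gamma,\mu^\beta x A(x)$ for any one $\gamma<\beta$; ($\nu^\beta$) the family $\{\Gamma,A(\nu^\gamma x A(x))\}_{\gamma<\beta}$ / $\Gamma,\nu^\beta x A(x)$. Proofs are well-founded (possibly infinitely branching) trees built from these rules. *)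

theory Defs
  imports Main "HOL-Library.Multiset"
begin

text \<open>
  Ordinals: \<open>\<alpha>\<close> is an arbitrary element of an arbitrary well-ordered type \<open>'o\<close>. The ordinals
  \<open>\<beta> \<le> \<alpha>\<close> are the elements of \<open>{..\<alpha>}\<close>, and \<open>\<alpha>\<close> itself is the order type of \<open>{..<\<alpha>}\<close>.

  Formulas are taken up to renaming of bound variables, by de Bruijn indices: below \<open>k\<close> enclosing
  binders, \<open>Var n\<close> is bound if \<open>n < k\<close> and otherwise denotes the free variable number \<open>n - k\<close>.
  Free variables are allowed in sequents. \<open>NProp p\<close> is the negated symbol \<open>p\<^sup>\<bottom>\<close>.
\<close>

datatype 'o fm =
    Var nat
  | Prop nat
  | NProp nat
  | One
  | Bot
  | Zero
  | Top
  | Tensor "'o fm" "'o fm"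
  | Par "'o fm" "'o fm"
  | Plus "'o fm" "'o fm"
  | With "'o fm" "'o fm"
  | Mu 'o "'o fm"
  | Nu 'o "'o fm"

text \<open>The formulas of the language for \<open>\<alpha>\<close>: all fixed point indices are at most \<open>\<alpha>\<close>.\<close>

primrec formula :: "'o::wellorder \<Rightarrow> 'o fm \<Rightarrow> bool" where
  "formula \<alpha> (Var n) \<longleftrightarrow> True"
| "formula \<alpha> (Prop p) \<longleftrightarrow> True"
| "formula \<alpha> (NProp p) \<longleftrightarrow> True"
| "formula \<alpha> One \<longleftrightarrow> True"
| "formula \<alpha> Bot \<longleftrightarrow> True"
| "formula \<alpha> Zero \<longleftrightarrow> True"
| "formula \<alpha> Top \<longleftrightarrow> True"
| "formula \<alpha> (Tensor A B) \<longleftrightarrow> formula \<alpha> A \<and> formula \<alpha> B"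
| "formula \<alpha> (Par A B) \<longleftrightarrow> formula \<alpha> A \<and> formula \<alpha> B"
| "formula \<alpha> (Plus A B) \<longleftrightarrow> formula \<alpha> A \<and> formula \<alpha> B"
| "formula \<alpha> (With A B) \<longleftrightarrow> formula \<alpha> A \<and> formula \<alpha> B"
| "formula \<alpha> (Mu \<beta> A) \<longleftrightarrow> \<beta> \<le> \<alpha> \<and> formula \<alpha> A"
| "formula \<alpha> (Nu \<beta> A) \<longleftrightarrow> \<beta> \<le> \<alpha> \<and> formula \<alpha> A"

definition sequent :: "'o::wellorder \<Rightarrow> 'o fm multiset \<Rightarrow> bool" where
  "sequent \<alpha> \<Gamma> \<longleftrightarrow> (\<forall>A\<in>#\<Gamma>. formula \<alpha> A)"

primrec neg :: "'o fm \<Rightarrow> 'o fm" where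
  "neg (Var n) = Var n"
| "neg (Prop p) = NProp p"
| "neg (NProp p) = Prop p"
| "neg One = Bot"
| "neg Bot = One"
| "neg Zero = Top"
| "neg Top = Zero"
| "neg (Tensor A B) = Par (neg A) (neg B)"
| "neg (Par A B) = Tensor (neg A) (neg B)"
| "neg (Plus A B) = With (neg A) (neg B)"
| "neg (With A B) = Plus (neg A) (neg B)"
| "neg (Mu \<beta> A) = Nu \<beta> (neg A)"
| "neg (Nu \<beta> A) = Mu \<beta> (neg A)"

lemma neg_neg [simp]: "neg (neg A) = A"
  by (induction A) auto

lemma formula_neg [simp]: "formula \<alpha> (neg A) \<longleftrightarrow> formula \<alpha> A"
  by (induction A) auto

primrec rename :: "(nat \<Rightarrow> nat) \<Rightarrow> 'o fm \<Rightarrow> 'o fm" where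
  "rename f (Var n) = Var (f n)"
| "rename f (Prop p) = Prop p"
| "rename f (NProp p) = NProp p"
| "rename f One = One"
| "rename f Bot = Bot"
| "rename f Zero = Zero"
| "rename f Top = Top"
| "rename f (Tensor A B) = Tensor (rename f A) (rename f B)"
| "rename f (Par A B) = Par (rename f A) (rename f B)"
| "rename f (Plus A B) = Plus (rename f A) (rename f B)"
| "rename f (With A B) = With (rename f A) (rename f B)"
| "rename f (Mu \<beta> A) = Mu \<beta> (rename (case_nat 0 (\<lambda>n. Suc (f n))) A)"
| "rename f (Nu \<beta> A) = Nu \<beta> (rename (case_nat 0 (\<lambda>n. Suc (f n))) A)"

text \<open>
  Simultaneous capture-avoiding substitution. Under a binder, index \<open>0\<close> is left alone and the free
  variables of the substituted formulas are shifted past the binder.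
\<close>

primrec subst :: "(nat \<Rightarrow> 'o fm) \<Rightarrow> 'o fm \<Rightarrow> 'o fm" where
  "subst \<sigma> (Var n) = \<sigma> n"
| "subst \<sigma> (Prop p) = Prop p"
| "subst \<sigma> (NProp p) = NProp p"
| "subst \<sigma> One = One"
| "subst \<sigma> Bot = Bot"
| "subst \<sigma> Zero = Zero"
| "subst \<sigma> Top = Top"
| "subst \<sigma> (Tensor A B) = Tensor (subst \<sigma> A) (subst \<sigma> B)"
| "subst \<sigma> (Par A B) = Par (subst \<sigma> A) (subst \<sigma> B)"
| "subst \<sigma> (Plus A B) = Plus (subst \<sigma> A) (subst \<sigma> B)"
| "subst \<sigma> (With A B) = With (subst \<sigma> A) (subst \<sigma> B)"
| "subst \<sigma> (Mu \<beta> A) = Mu \<beta> (subst (case_nat (Var 0) (\<lambda>n. rename Suc (\<sigma> n))) A)"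
| "subst \<sigma> (Nu \<beta> A) = Nu \<beta> (subst (case_nat (Var 0) (\<lambda>n. rename Suc (\<sigma> n))) A)"

text \<open>
  If \<open>A\<close> is the body of \<open>\<mu>\<^sup>\<beta> x A(x)\<close> or \<open>\<nu>\<^sup>\<beta> x A(x)\<close>, then \<open>inst A B\<close> is \<open>A(B)\<close>: the variable of the
  removed binder, index \<open>0\<close>, becomes \<open>B\<close> and the indices of all other variables drop by one.
\<close>

definition inst :: "'o fm \<Rightarrow> 'o fm \<Rightarrow> 'o fm" where
  "inst A B = subst (case_nat B Var) A"

text \<open>
  The first argument of \<open>derivable\<close> says whether the cut rule is available. The premises about
  \<open>sequent\<close> and \<open>formula\<close> are placed exactly where a rule could introduce a formula outside the
  language for \<open>\<alpha>\<close>; lemma \<open>derivable_sequent\<close> below shows that they suffice. In rule \<open>nu\<close> they matter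
  if \<open>\<beta>\<close> is the least ordinal, where the family of premises is empty.
\<close>

inductive derivable :: "bool \<Rightarrow> 'o::wellorder \<Rightarrow> 'o fm multiset \<Rightarrow> bool"
  for c :: bool and \<alpha> :: "'o::wellorder" where
  ax: "formula \<alpha> A \<Longrightarrow> derivable c \<alpha> {#A, neg A#}"
| cut: "c \<Longrightarrow> derivable c \<alpha> (\<Gamma> + {#A#}) \<Longrightarrow> derivable c \<alpha> (\<Delta> + {#neg A#}) \<Longrightarrow>
    derivable c \<alpha> (\<Gamma> + \<Delta>)"
| one: "derivable c \<alpha> {#One#}"
| bot: "derivable c \<alpha> \<Gamma> \<Longrightarrow> derivable c \<alpha> (\<Gamma> + {#Bot#})"
| top: "sequent \<alpha> \<Gamma> \<Longrightarrow> derivable c \<alpha> (\<Gamma> + {#Top#})"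
| tensor: "derivable c \<alpha> (\<Gamma> + {#A#}) \<Longrightarrow> derivable c \<alpha> (\<Delta> + {#B#}) \<Longrightarrow>
    derivable c \<alpha> (\<Gamma> + \<Delta> + {#Tensor A B#})"
| par: "derivable c \<alpha> (\<Gamma> + {#A, B#}) \<Longrightarrow> derivable c \<alpha> (\<Gamma> + {#Par A B#})"
| plus0: "derivable c \<alpha> (\<Gamma> + {#A#}) \<Longrightarrow> formula \<alpha> B \<Longrightarrow> derivable c \<alpha> (\<Gamma> + {#Plus A B#})"
| plus1: "derivable c \<alpha> (\<Gamma> + {#B#}) \<Longrightarrow> formula \<alpha> A \<Longrightarrow> derivable c \<alpha> (\<Gamma> + {#Plus A B#})"
| "with": "derivable c \<alpha> (\<Gamma> + {#A#}) \<Longrightarrow> derivable c \<alpha> (\<Gamma> + {#B#}) \<Longrightarrow>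
    derivable c \<alpha> (\<Gamma> + {#With A B#})"
| mu: "formula \<alpha> (Mu \<beta> A) \<Longrightarrow> \<gamma> < \<beta> \<Longrightarrow> derivable c \<alpha> (\<Gamma> + {#inst A (Mu \<gamma> A)#}) \<Longrightarrow>
    derivable c \<alpha> (\<Gamma> + {#Mu \<beta> A#})"
| nu: "sequent \<alpha> (\<Gamma> + {#Nu \<beta> A#}) \<Longrightarrow>
    (\<And>\<gamma>. \<gamma> < \<beta> \<Longrightarrow> derivable c \<alpha> (\<Gamma> + {#inst A (Nu \<gamma> A)#})) \<Longrightarrow>
    derivable c \<alpha> (\<Gamma> + {#Nu \<beta> A#})"

abbreviation provable :: "'o::wellorder \<Rightarrow> 'o fm multiset \<Rightarrow> bool" where
  "provable \<equiv> derivable True"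

abbreviation provable_cf :: "'o::wellorder \<Rightarrow> 'o fm multiset \<Rightarrow> bool" where
  "provable_cf \<equiv> derivable False"

lemma derivable_sequent: "derivable c \<alpha> \<Gamma> \<Longrightarrow> sequent \<alpha> \<Gamma>"
  by (induction rule: derivable.induct) (auto simp: sequent_def)

end

theory Submission imports Defs
begin

text \<open>
  Two facts make cut elimination work.

  First, fixed point indices make unfolding well-founded. A formula \<open>\<mu>\<^sup>\<beta> x A\<close> unfolds only to
  \<open>A(\<mu>\<^sup>\<gamma> x A)\<close> with \<open>\<gamma> < \<beta>\<close>, which may be a larger formula, and yet every sequence of such unfoldings
  and of steps to immediate subformulas ends. This is the induction principle \<open>unfolding_induct\<close>. Its
  proof has the shape of a reducibility argument: the property to be shown is generalised to all
  substitution instances by formulas that have it, and \<open>\<mu>\<^sup>\<beta> x A\<close> is then treated by induction on \<open>\<beta>\<close>.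

  Secondly, in the absence of contraction a cut formula, traced upwards through a cut-free proof,
  never occurs more than once in a sequent; every branch leads to a rule that introduces it, to an
  axiom, or to a rule that discards it. Lemma \<open>replace_occurrence\<close> expresses this: given a proof of
  \<open>\<Delta>, A\<^sup>\<bottom>\<close>, if \<open>\<Delta>\<close> can take the place of \<open>A\<close> in the conclusion of each rule introducing \<open>A\<close>, then it
  can take the place of \<open>A\<close> in every cut-free provable sequent. Applied once to \<open>A\<close> and once to
  \<open>A\<^sup>\<bottom>\<close>, it reduces a cut to the case in which both cut formulas have just been introduced, and there
  the usual reductions lead to cuts on immediate subformulas or on unfoldings. The inner inductions
  follow the structure of the proofs, so infinite branching does no harm.
\<close>

section \<open>Substitution\<close>

lemma subst_rename: "subst \<sigma> (rename f A) = subst (\<lambda>n. \<sigma> (f n)) A"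
proof (induction A arbitrary: \<sigma> f)
  case (Mu \<beta> A)
  have "(\<lambda>n. case_nat (Var 0) (\<lambda>n. rename Suc (\<sigma> n)) (case_nat 0 (\<lambda>n. Suc (f n)) n))
      = case_nat (Var 0) (\<lambda>n. rename Suc (\<sigma> (f n)))"
    by (auto split: nat.split)
  with Mu show ?case by simp
next
  case (Nu \<beta> A)
  have "(\<lambda>n. case_nat (Var 0) (\<lambda>n. rename Suc (\<sigma> n)) (case_nat 0 (\<lambda>n. Suc (f n)) n))
      = case_nat (Var 0) (\<lambda>n. rename Suc (\<sigma> (f n)))"
    by (auto split: nat.split)
  with Nu show ?case by simp
qed auto

lemma rename_rename: "rename f (rename g A) = rename (\<lambda>n. f (g n)) A"
proof (induction A arbitrary: f g)
  case (Mu \<beta> A)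
  have "(\<lambda>n. case_nat 0 (\<lambda>n. Suc (f n)) (case_nat 0 (\<lambda>n. Suc (g n)) n))
      = case_nat 0 (\<lambda>n. Suc (f (g n)))"
    by (auto split: nat.split)
  with Mu show ?case by simp
next
  case (Nu \<beta> A)
  have "(\<lambda>n. case_nat 0 (\<lambda>n. Suc (f n)) (case_nat 0 (\<lambda>n. Suc (g n)) n))
      = case_nat 0 (\<lambda>n. Suc (f (g n)))"
    by (auto split: nat.split)
  with Nu show ?case by simp
qed auto

lemma rename_subst: "rename f (subst \<sigma> A) = subst (\<lambda>n. rename f (\<sigma> n)) A"
proof (induction A arbitrary: \<sigma> f)
  case (Mu \<beta> A)
  have "(\<lambda>n. rename (case_nat 0 (\<lambda>n. Suc (f n))) (case_nat (Var 0) (\<lambda>n. rename Suc (\<sigma> n)) n))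
      = case_nat (Var 0) (\<lambda>n. rename Suc (rename f (\<sigma> n)))"
    by (auto simp: rename_rename split: nat.split)
  with Mu show ?case by simp
next
  case (Nu \<beta> A)
  have "(\<lambda>n. rename (case_nat 0 (\<lambda>n. Suc (f n))) (case_nat (Var 0) (\<lambda>n. rename Suc (\<sigma> n)) n))
      = case_nat (Var 0) (\<lambda>n. rename Suc (rename f (\<sigma> n)))"
    by (auto simp: rename_rename split: nat.split)
  with Nu show ?case by simp
qed auto

lemma subst_subst: "subst \<tau> (subst \<sigma> A) = subst (\<lambda>n. subst \<tau> (\<sigma> n)) A"
proof (induction A arbitrary: \<sigma> \<tau>)
  case (Mu \<beta> A)
  have "(\<lambda>n. subst (case_nat (Var 0) (\<lambda>n. rename Suc (\<tau> n)))
        (case_nat (Var 0) (\<lambda>n. rename Suc (\<sigma> n)) n))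
      = case_nat (Var 0) (\<lambda>n. rename Suc (subst \<tau> (\<sigma> n)))"
    by (auto simp: subst_rename rename_subst split: nat.split)
  with Mu show ?case by simp
next
  case (Nu \<beta> A)
  have "(\<lambda>n. subst (case_nat (Var 0) (\<lambda>n. rename Suc (\<tau> n)))
        (case_nat (Var 0) (\<lambda>n. rename Suc (\<sigma> n)) n))
      = case_nat (Var 0) (\<lambda>n. rename Suc (subst \<tau> (\<sigma> n)))"
    by (auto simp: subst_rename rename_subst split: nat.split)
  with Nu show ?case by simp
qed auto

lemma subst_Var [simp]:
  fixes A :: "'o fm"
  shows "subst Var A = A"
proof (induction A)
  case (Mu \<beta> A)
  have "case_nat (Var 0) (\<lambda>n. Var (Suc n)) = (Var :: nat \<Rightarrow> 'o fm)"
    by (auto split: nat.split)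
  with Mu show ?case by simp
next
  case (Nu \<beta> A)
  have "case_nat (Var 0) (\<lambda>n. Var (Suc n)) = (Var :: nat \<Rightarrow> 'o fm)"
    by (auto split: nat.split)
  with Nu show ?case by simp
qed auto

lemma inst_subst:
  "inst (subst (case_nat (Var 0) (\<lambda>n. rename Suc (\<sigma> n))) A) B = subst (case_nat B \<sigma>) A"
proof -
  have "(\<lambda>n. subst (case_nat B Var) (case_nat (Var 0) (\<lambda>n. rename Suc (\<sigma> n)) n)) = case_nat B \<sigma>"
    by (auto simp: subst_rename split: nat.split)
  then show ?thesis
    by (simp add: inst_def subst_subst)
qed

lemma neg_rename: "neg (rename f A) = rename f (neg A)"
  by (induction A arbitrary: f) auto

lemma neg_subst: "neg (subst \<sigma> A) = subst (\<lambda>n. neg (\<sigma> n)) (neg A)"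
proof (induction A arbitrary: \<sigma>)
  case (Mu \<beta> A)
  have "(\<lambda>n. neg (case_nat (Var 0) (\<lambda>n. rename Suc (\<sigma> n)) n))
      = case_nat (Var 0) (\<lambda>n. rename Suc (neg (\<sigma> n)))"
    by (auto simp: neg_rename split: nat.split)
  with Mu show ?case by simp
next
  case (Nu \<beta> A)
  have "(\<lambda>n. neg (case_nat (Var 0) (\<lambda>n. rename Suc (\<sigma> n)) n))
      = case_nat (Var 0) (\<lambda>n. rename Suc (neg (\<sigma> n)))"
    by (auto simp: neg_rename split: nat.split)
  with Nu show ?case by simp
qed auto

text \<open>Unfoldings of dual fixed points are dual; this depends on the convention \<open>x\<^sup>\<bottom> = x\<close>.\<close>

lemma neg_inst: "neg (inst A B) = inst (neg A) (neg B)"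
proof -
  have "(\<lambda>n. neg (case_nat B Var n)) = case_nat (neg B) Var"
    by (auto split: nat.split)
  then show ?thesis
    by (simp add: inst_def neg_subst)
qed

section \<open>Induction along unfoldings\<close>

text \<open>
  Structural induction fails at fixed points, since the variable bound in \<open>A\<close> is replaced by a new
  fixed point formula. It goes through for the statement that \<open>P\<close> holds of \<open>subst \<sigma> A\<close> whenever \<open>P\<close>
  holds of all values of \<open>\<sigma>\<close>: the unfolding of \<open>subst \<sigma> (\<mu>\<^sup>\<beta> x A)\<close> at \<open>\<gamma>\<close> is an instance of \<open>A\<close> by \<open>\<sigma>\<close>
  extended with \<open>subst \<sigma> (\<mu>\<^sup>\<gamma> x A)\<close>, of which \<open>P\<close> holds by induction on the index.
\<close>

lemma unfolding_induct [case_names Var Prop NProp One Bot Zero Top Tensor Par Plus With Mu Nu]: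
  fixes P :: "'o::wellorder fm \<Rightarrow> bool"
  assumes Var: "\<And>n. P (Var n)"
    and Prop: "\<And>p. P (Prop p)" "\<And>p. P (NProp p)"
    and units: "P One" "P Bot" "P Zero" "P Top"
    and Tensor: "\<And>A B. P A \<Longrightarrow> P B \<Longrightarrow> P (Tensor A B)"
    and Par: "\<And>A B. P A \<Longrightarrow> P B \<Longrightarrow> P (Par A B)"
    and Plus: "\<And>A B. P A \<Longrightarrow> P B \<Longrightarrow> P (Plus A B)"
    and With: "\<And>A B. P A \<Longrightarrow> P B \<Longrightarrow> P (With A B)"
    and Mu: "\<And>\<beta> A. (\<And>\<gamma>. \<gamma> < \<beta> \<Longrightarrow> P (inst A (Mu \<gamma> A))) \<Longrightarrow> P (Mu \<beta> A)"
    and Nu: "\<And>\<beta> A. (\<And>\<gamma>. \<gamma> < \<beta> \<Longrightarrow> P (inst A (Nu \<gamma> A))) \<Longrightarrow> P (Nu \<beta> A)"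
  shows "P A"
proof -
  have "P (subst \<sigma> A)" if "\<And>n. P (\<sigma> n)" for \<sigma>
    using that
  proof (induction A arbitrary: \<sigma>)
    case (Mu \<beta> A)
    let ?B = "subst (case_nat (Var 0) (\<lambda>n. rename Suc (\<sigma> n))) A"
    have "P (Mu \<beta> ?B)"
    proof (induction \<beta> rule: less_induct)
      case (less \<beta>)
      have "P (inst ?B (Mu \<gamma> ?B))" if "\<gamma> < \<beta>" for \<gamma>
        unfolding inst_subst
        by (rule Mu.IH) (auto simp: less[OF that] Mu.prems split: nat.split)
      then show ?case
        by (rule assms)
    qed
    then show ?case by simp
  next
    case (Nu \<beta> A)
    let ?B = "subst (case_nat (Var 0) (\<lambda>n. rename Suc (\<sigma> n))) A"
    have "P (Nu \<beta> ?B)"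
    proof (induction \<beta> rule: less_induct)
      case (less \<beta>)
      have "P (inst ?B (Nu \<gamma> ?B))" if "\<gamma> < \<beta>" for \<gamma>
        unfolding inst_subst
        by (rule Nu.IH) (auto simp: less[OF that] Nu.prems split: nat.split)
      then show ?case
        by (rule assms)
    qed
    then show ?case by simp
  qed (auto intro: assms)
  from this[of Var] show ?thesis
    by (simp add: Var)
qed

section \<open>Tracing an occurrence through a cut-free proof\<close>

text \<open>
  \<open>introduces \<alpha> A \<Gamma>\<close> says that \<open>\<Gamma>, A\<close> is the conclusion of a cut-free proof whose last rule is a
  logical rule with principal formula \<open>A\<close>. Axioms do not count: they need no case
  analysis when \<open>A\<close> is cut.
\<close>

inductive introduces :: "'o::wellorder \<Rightarrow> 'o fm \<Rightarrow> 'o fm multiset \<Rightarrow> bool" for \<alpha> where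
  "introduces \<alpha> One {#}"
| "provable_cf \<alpha> \<Gamma> \<Longrightarrow> introduces \<alpha> Bot \<Gamma>"
| "sequent \<alpha> \<Gamma> \<Longrightarrow> introduces \<alpha> Top \<Gamma>"
| "provable_cf \<alpha> (\<Gamma> + {#A#}) \<Longrightarrow> provable_cf \<alpha> (\<Delta> + {#B#}) \<Longrightarrow>
    introduces \<alpha> (Tensor A B) (\<Gamma> + \<Delta>)"
| "provable_cf \<alpha> (\<Gamma> + {#A, B#}) \<Longrightarrow> introduces \<alpha> (Par A B) \<Gamma>"
| "provable_cf \<alpha> (\<Gamma> + {#A#}) \<Longrightarrow> formula \<alpha> B \<Longrightarrow> introduces \<alpha> (Plus A B) \<Gamma>"
| "provable_cf \<alpha> (\<Gamma> + {#B#}) \<Longrightarrow> formula \<alpha> A \<Longrightarrow> introduces \<alpha> (Plus A B) \<Gamma>"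
| "provable_cf \<alpha> (\<Gamma> + {#A#}) \<Longrightarrow> provable_cf \<alpha> (\<Gamma> + {#B#}) \<Longrightarrow> introduces \<alpha> (With A B) \<Gamma>"
| "formula \<alpha> (Mu \<beta> A) \<Longrightarrow> \<gamma> < \<beta> \<Longrightarrow> provable_cf \<alpha> (\<Gamma> + {#inst A (Mu \<gamma> A)#}) \<Longrightarrow>
    introduces \<alpha> (Mu \<beta> A) \<Gamma>"
| "sequent \<alpha> (\<Gamma> + {#Nu \<beta> A#}) \<Longrightarrow>
    (\<And>\<gamma>. \<gamma> < \<beta> \<Longrightarrow> provable_cf \<alpha> (\<Gamma> + {#inst A (Nu \<gamma> A)#})) \<Longrightarrow> introduces \<alpha> (Nu \<beta> A) \<Gamma>"

lemma introduces_provable_cf: "introduces \<alpha> A \<Gamma> \<Longrightarrow> provable_cf \<alpha> (\<Gamma> + {#A#})"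
proof (induction rule: introduces.induct)
  case 1
  then show ?case using derivable.one by simp
qed (rule derivable.intros; assumption)+

lemma add_single_eq_cases:
  assumes "\<Gamma> + {#P#} = \<Gamma>' + {#A#}"
  obtains (principal) "P = A" "\<Gamma> = \<Gamma>'"
  | (side) K where "\<Gamma> = K + {#A#}" "\<Gamma>' = K + {#P#}"
  using assms by (auto simp: add_eq_conv_ex)

text \<open>
  Below a rule in which \<open>A\<close> is a side formula, the replacement is pushed into the premises that
  contain \<open>A\<close>. For an axiom \<open>A, A\<^sup>\<bottom>\<close> the result is the given proof of \<open>\<Delta>, A\<^sup>\<bottom>\<close>.
\<close>

lemma replace_occurrence:
  assumes "provable_cf \<alpha> (\<Gamma> + {#A#})"
    and dual: "provable_cf \<alpha> (\<Delta> + {#neg A#})"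
    and intro: "\<And>\<Gamma>'. introduces \<alpha> A \<Gamma>' \<Longrightarrow> provable_cf \<alpha> (\<Gamma>' + \<Delta>)"
  shows "provable_cf \<alpha> (\<Gamma> + \<Delta>)"
proof -
  have seq: "sequent \<alpha> \<Delta>"
    using derivable_sequent[OF dual] by (simp add: sequent_def)
  have "provable_cf \<alpha> (\<Gamma> + \<Delta>)" if "provable_cf \<alpha> S" "S = \<Gamma> + {#A#}" for S
    using that
  proof (induction arbitrary: \<Gamma> rule: derivable.induct)
    case (ax B)
    then have "\<Gamma> = {#neg A#}"
      by (auto simp: add_eq_conv_ex)
    with dual show ?case by (simp add: add.commute)
  next
    case (cut \<Gamma>1 A1 \<Delta>1)
    then show ?case by simp
  next
    case one
    then have "introduces \<alpha> A \<Gamma>"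
      by (auto intro: introduces.intros)
    then show ?case by (rule intro)
  next
    case (bot \<Gamma>1)
    from bot.prems show ?case
    proof (cases rule: add_single_eq_cases)
      case principal
      with bot.hyps show ?thesis by (auto intro!: intro introduces.intros)
    next
      case (side K)
      with bot.IH[of K] derivable.bot[of False \<alpha> "K + \<Delta>"] show ?thesis
        by (simp add: ac_simps)
    qed
  next
    case (top \<Gamma>1)
    from top.prems show ?case
    proof (cases rule: add_single_eq_cases)
      case principal
      with top.hyps show ?thesis by (auto intro!: intro introduces.intros)
    next
      case (side K)
      with top.hyps seq have "sequent \<alpha> (K + \<Delta>)"
        by (auto simp: sequent_def)
      from derivable.top[OF this] side show ?thesis
        by (simp add: ac_simps)
    qed
  next
    case (tensor \<Gamma>1 B1 \<Gamma>2 B2)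
    from tensor.prems show ?case
    proof (cases rule: add_single_eq_cases)
      case principal
      with tensor.hyps show ?thesis by (auto intro!: intro introduces.intros)
    next
      case (side K)
      then have "A \<in># \<Gamma>1 \<or> A \<in># \<Gamma>2"
        by (metis union_iff union_single_eq_member add_mset_add_single)
      then show ?thesis
      proof
        assume "A \<in># \<Gamma>1"
        then obtain K1 where K1: "\<Gamma>1 = K1 + {#A#}"
          by (metis insert_DiffM2)
        with side have "K = K1 + \<Gamma>2" by simp
        moreover have "provable_cf \<alpha> (K1 + \<Delta> + {#B1#})"
          using tensor.IH(1)[of "K1 + {#B1#}"] K1 by (simp add: ac_simps)
        from derivable.tensor[OF this tensor.hyps(2)]
        have "provable_cf \<alpha> (K1 + \<Gamma>2 + {#Tensor B1 B2#} + \<Delta>)" by (simp add: ac_simps)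
        ultimately show ?thesis using side by simp
      next
        assume "A \<in># \<Gamma>2"
        then obtain K2 where K2: "\<Gamma>2 = K2 + {#A#}"
          by (metis insert_DiffM2)
        with side have "K = \<Gamma>1 + K2" by simp
        moreover have "provable_cf \<alpha> (K2 + \<Delta> + {#B2#})"
          using tensor.IH(2)[of "K2 + {#B2#}"] K2 by (simp add: ac_simps)
        from derivable.tensor[OF tensor.hyps(1) this]
        have "provable_cf \<alpha> (\<Gamma>1 + K2 + {#Tensor B1 B2#} + \<Delta>)" by (simp add: ac_simps)
        ultimately show ?thesis using side by simp
      qed
    qed
  next
    case (par \<Gamma>1 B1 B2)
    from par.prems show ?case
    proof (cases rule: add_single_eq_cases)
      case principal
      with par.hyps show ?thesis by (auto intro!: intro introduces.intros)
    next
      case (side K)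
      with par.IH[of "K + {#B1, B2#}"] derivable.par[of False \<alpha> "K + \<Delta>" B1 B2] show ?thesis
        by (simp add: ac_simps)
    qed
  next
    case (plus0 \<Gamma>1 B1 B2)
    from plus0.prems show ?case
    proof (cases rule: add_single_eq_cases)
      case principal
      with plus0.hyps show ?thesis by (auto intro!: intro introduces.intros(6))
    next
      case (side K)
      with plus0.hyps plus0.IH[of "K + {#B1#}"] derivable.plus0[of False \<alpha> "K + \<Delta>" B1 B2]
      show ?thesis
        by (simp add: ac_simps)
    qed
  next
    case (plus1 \<Gamma>1 B2 B1)
    from plus1.prems show ?case
    proof (cases rule: add_single_eq_cases)
      case principal
      with plus1.hyps show ?thesis by (auto intro!: intro introduces.intros(7))
    next
      case (side K)
      with plus1.hyps plus1.IH[of "K + {#B2#}"] derivable.plus1[of False \<alpha> "K + \<Delta>" B2 B1]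
      show ?thesis
        by (simp add: ac_simps)
    qed
  next
    case ("with" \<Gamma>1 B1 B2)
    from with.prems show ?case
    proof (cases rule: add_single_eq_cases)
      case principal
      with with.hyps show ?thesis by (auto intro!: intro introduces.intros)
    next
      case (side K)
      with with.IH(1)[of "K + {#B1#}"] with.IH(2)[of "K + {#B2#}"]
        derivable.with[of False \<alpha> "K + \<Delta>" B1 B2]
      show ?thesis
        by (simp add: ac_simps)
    qed
  next
    case (mu \<beta> B \<gamma> \<Gamma>1)
    from mu.prems show ?case
    proof (cases rule: add_single_eq_cases)
      case principal
      with mu.hyps show ?thesis by (auto intro!: intro introduces.intros)
    next
      case (side K)
      with mu.hyps mu.IH[of "K + {#inst B (Mu \<gamma> B)#}"]
        derivable.mu[of \<alpha> \<beta> B \<gamma> False "K + \<Delta>"]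
      show ?thesis
        by (simp add: ac_simps)
    qed
  next
    case (nu \<Gamma>1 \<beta> B)
    from nu.prems show ?case
    proof (cases rule: add_single_eq_cases)
      case principal
      with nu.hyps show ?thesis by (auto intro!: intro introduces.intros)
    next
      case (side K)
      have "provable_cf \<alpha> (K + \<Delta> + {#inst B (Nu \<gamma> B)#})" if "\<gamma> < \<beta>" for \<gamma>
        using nu.IH[OF that, of "K + {#inst B (Nu \<gamma> B)#}"] side by (simp add: ac_simps)
      moreover have "sequent \<alpha> (K + \<Delta> + {#Nu \<beta> B#})"
        using nu.hyps(1) side seq by (auto simp: sequent_def)
      ultimately have "provable_cf \<alpha> (K + \<Delta> + {#Nu \<beta> B#})"
        by (rule derivable.nu[rotated])
      with side show ?thesis
        by (simp add: ac_simps)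
    qed
  qed
  with assms(1) show ?thesis by blast
qed

section \<open>Cut elimination\<close>

definition cut_admissible :: "'o::wellorder \<Rightarrow> 'o fm \<Rightarrow> bool" where
  "cut_admissible \<alpha> A \<longleftrightarrow> (\<forall>\<Gamma> \<Delta>. provable_cf \<alpha> (\<Gamma> + {#A#}) \<longrightarrow>
     provable_cf \<alpha> (\<Delta> + {#neg A#}) \<longrightarrow> provable_cf \<alpha> (\<Gamma> + \<Delta>))"

lemma cut_admissibleD:
  assumes "cut_admissible \<alpha> A"
    and "provable_cf \<alpha> (\<Gamma> + {#A#})" "provable_cf \<alpha> (\<Delta> + {#neg A#})"
  shows "provable_cf \<alpha> (\<Gamma> + \<Delta>)"
  using assms by (simp add: cut_admissible_def)

lemma cut_admissible_neg: "cut_admissible \<alpha> (neg A) \<longleftrightarrow> cut_admissible \<alpha> A"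
  unfolding cut_admissible_def by (metis add.commute neg_neg)

text \<open>
  The occurrence of \<open>A\<close> in the first proof is replaced by \<open>\<Delta>\<close>; where \<open>A\<close> is introduced, with context
  \<open>\<Gamma>'\<close>, the occurrence of \<open>A\<^sup>\<bottom>\<close> in the second proof is replaced by \<open>\<Gamma>'\<close> in turn.
\<close>

lemma cut_admissible_if_principal:
  assumes "\<And>\<Gamma> \<Delta>. introduces \<alpha> A \<Gamma> \<Longrightarrow> introduces \<alpha> (neg A) \<Delta> \<Longrightarrow> provable_cf \<alpha> (\<Gamma> + \<Delta>)"
  shows "cut_admissible \<alpha> A"
  unfolding cut_admissible_def
proof (intro allI impI)
  fix \<Gamma> \<Delta>
  assume A: "provable_cf \<alpha> (\<Gamma> + {#A#})" and nA: "provable_cf \<alpha> (\<Delta> + {#neg A#})"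
  from A nA show "provable_cf \<alpha> (\<Gamma> + \<Delta>)"
  proof (rule replace_occurrence)
    fix \<Gamma>'
    assume intro: "introduces \<alpha> A \<Gamma>'"
    have "provable_cf \<alpha> (\<Delta> + \<Gamma>')"
      using nA
    proof (rule replace_occurrence)
      show "provable_cf \<alpha> (\<Gamma>' + {#neg (neg A)#})"
        using introduces_provable_cf[OF intro] by simp
    next
      fix \<Delta>'
      assume "introduces \<alpha> (neg A) \<Delta>'"
      with intro show "provable_cf \<alpha> (\<Delta>' + \<Gamma>')"
        using assms by (metis add.commute)
    qed
    then show "provable_cf \<alpha> (\<Gamma>' + \<Delta>)" by (simp add: add.commute)
  qed
qed

lemma cut_admissible_Tensor:
  assumes "cut_admissible \<alpha> A" "cut_admissible \<alpha> B"
  shows "cut_admissible \<alpha> (Tensor A B)"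
proof (rule cut_admissible_if_principal)
  fix \<Gamma> \<Delta>
  assume "introduces \<alpha> (Tensor A B) \<Gamma>" "introduces \<alpha> (neg (Tensor A B)) \<Delta>"
  then obtain \<Gamma>1 \<Gamma>2 where \<Gamma>: "\<Gamma> = \<Gamma>1 + \<Gamma>2"
    and prems: "provable_cf \<alpha> (\<Gamma>1 + {#A#})" "provable_cf \<alpha> (\<Gamma>2 + {#B#})"
      "provable_cf \<alpha> (\<Delta> + {#neg A, neg B#})"
    by (auto elim!: introduces.cases)
  from prems(3) have "provable_cf \<alpha> ((\<Delta> + {#neg B#}) + {#neg A#})"
    by (simp add: add_mset_commute)
  from cut_admissibleD[OF assms(1) prems(1) this]
  have "provable_cf \<alpha> ((\<Gamma>1 + \<Delta>) + {#neg B#})" by (simp add: ac_simps)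
  from cut_admissibleD[OF assms(2) prems(2) this] show "provable_cf \<alpha> (\<Gamma> + \<Delta>)"
    by (simp add: \<Gamma> ac_simps)
qed

lemma cut_admissible_Plus:
  assumes "cut_admissible \<alpha> A" "cut_admissible \<alpha> B"
  shows "cut_admissible \<alpha> (Plus A B)"
proof (rule cut_admissible_if_principal)
  fix \<Gamma> \<Delta>
  assume "introduces \<alpha> (Plus A B) \<Gamma>" "introduces \<alpha> (neg (Plus A B)) \<Delta>"
  then have "provable_cf \<alpha> (\<Gamma> + {#A#}) \<or> provable_cf \<alpha> (\<Gamma> + {#B#})"
    and "provable_cf \<alpha> (\<Delta> + {#neg A#})" "provable_cf \<alpha> (\<Delta> + {#neg B#})"
    by (auto elim!: introduces.cases)
  with assms show "provable_cf \<alpha> (\<Gamma> + \<Delta>)"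
    by (blast intro: cut_admissibleD)
qed

lemma cut_admissible_Mu:
  assumes "\<And>\<gamma>. \<gamma> < \<beta> \<Longrightarrow> cut_admissible \<alpha> (inst A (Mu \<gamma> A))"
  shows "cut_admissible \<alpha> (Mu \<beta> A)"
proof (rule cut_admissible_if_principal)
  fix \<Gamma> \<Delta>
  assume "introduces \<alpha> (Mu \<beta> A) \<Gamma>" "introduces \<alpha> (neg (Mu \<beta> A)) \<Delta>"
  then obtain \<gamma> where \<gamma>: "\<gamma> < \<beta>" "provable_cf \<alpha> (\<Gamma> + {#inst A (Mu \<gamma> A)#})"
    and "provable_cf \<alpha> (\<Delta> + {#inst (neg A) (Nu \<gamma> (neg A))#})"
    by (auto elim!: introduces.cases)
  then have "provable_cf \<alpha> (\<Delta> + {#neg (inst A (Mu \<gamma> A))#})"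
    by (simp add: neg_inst)
  with \<gamma> assms show "provable_cf \<alpha> (\<Gamma> + \<Delta>)"
    by (blast intro: cut_admissibleD)
qed

text \<open>
  Each pair of dual connectives is treated on one side only; the other side is the same cut with its
  premises exchanged.
\<close>

lemma cut_admissible: "cut_admissible \<alpha> A"
proof (induction A rule: unfolding_induct)
  case (Tensor A B)
  then show ?case by (rule cut_admissible_Tensor)
next
  case (Par A B)
  then show ?case
    using cut_admissible_Tensor[of \<alpha> "neg A" "neg B"] cut_admissible_neg[of \<alpha> "Par A B"]
    by (simp add: cut_admissible_neg)
next
  case (Plus A B)
  then show ?case by (rule cut_admissible_Plus)
next
  case (With A B)
  then show ?case
    using cut_admissible_Plus[of \<alpha> "neg A" "neg B"] cut_admissible_neg[of \<alpha> "With A B"]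
    by (simp add: cut_admissible_neg)
next
  case (Mu \<beta> A)
  then show ?case by (rule cut_admissible_Mu)
next
  case (Nu \<beta> A)
  have "cut_admissible \<alpha> (inst (neg A) (Mu \<gamma> (neg A)))" if "\<gamma> < \<beta>" for \<gamma>
    using Nu[OF that] cut_admissible_neg[of \<alpha> "inst A (Nu \<gamma> A)"] by (simp add: neg_inst)
  from cut_admissible_Mu[OF this] show ?case
    using cut_admissible_neg[of \<alpha> "Nu \<beta> A"] by simp
qed (rule cut_admissible_if_principal; auto elim!: introduces.cases)+

theorem theorem3p5:
  fixes \<alpha> :: "'o::wellorder" and \<Gamma> :: "'o fm multiset"
  assumes "sequent \<alpha> \<Gamma>"
    and "provable \<alpha> \<Gamma>"
  shows "provable_cf \<alpha> \<Gamma>"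
  using assms(2)
proof (induction rule: derivable.induct)
  case (cut \<Gamma> A \<Delta>)
  from cut.IH show ?case
    by (rule cut_admissibleD[OF cut_admissible])
qed (rule derivable.intros; assumption)+

end
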